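(* Let $D \subseteq \mathbb{O}$ be a domain and let $f : D \to \mathbb{O}$ be a $C^1(D)$-function satisfying $\frac{\partial f}{\partial x_0}(z) \neq 0$ for all $z \in D$. Then $f$ is conformal in the sense of Gauss if and only if there exist seven continuous functions $\Psi_1,\ldots,\Psi_7 : D \to \mathbb{O}$ such that for all $z \in D$: (i) $\Re(\Psi_i(z)) = 0$ for $i = 1,\ldots,7$; (ii) $\langle \Psi_i(z), \Psi_j(z) \rangle = \delta_{ij}$ for all $i,j \in \{1,\ldots,7\}$; and $$\frac{\partial f}{\partial x_k}(z) = \Psi_k(z)\, \frac{\partial f}{\partial x_0}(z), \qquad k = 1,\ldots,7,$$ where the product on the right-hand side is the octonionic product.
   Context: $\mathbb{O}$ denotes the real octonion algebra with elements $z = x_0 + x_1 e_1 + \cdots + x_7 e_7$, $x_i \in \mathbb{R}$, identified with $\mathbb{R}^8$ as a real vector space. The multiplication is bilinear with unit $1$, $e_i^2 = -1$, $e_i e_j = -e_j e_i$ for $i \ne j$ in $\{1,\ldots,7\}$, and $e_i e_j = e_k$ whenever $(i,j,k)$ is a cyclic permutation of one of $(1,2,4)$, $(1,3,5)$, $(2,3,6)$, $(4,3,7)$, $(6,1,7)$, $(2,5,7)$, $(4,6,5)$. The real part of $a = a_0 + \sum_{i=1}^7 a_i e_i$ is $\Re(a) = a_0$; its conjugate is $\overline{a} = a_0 - \sum_{i=1}^7 a_i e_i$. The scalar product is the Euclidean one, $\langle a,b\rangle = \sum_{i=0}^7 a_i b_i = \Re(a\overline{b})$, and $|a| = \sqrt{\langle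 a,a\rangle}$. $\delta_{ij}$ is the Kronecker symbol. A domain is a nonempty connected open set. A $C^1(D)$-function $f : D \to \mathbb{O}$ is one whose real component functions are continuously differentiable on $D$; its partial derivatives $\frac{\partial f}{\partial x_i}$ ($i=0,\ldots,7$) are octonion-valued. Such an $f$ is called conformal in the sense of Gauss if there is a function $\lambda : D \to \mathbb{R}^{>0}$ with $|df|^2 = \lambda(z) |dz|^2$ on $D$, where $df = \sum_{i=0}^7 \frac{\partial f}{\partial x_i} dx_i$ and $dz = dx_0 + \sum_{i=1}^7 e_i\, dx_i$; that is, $\left| \sum_{i=0}^7 v_i \frac{\partial f}{\partial x_i}(z) \right|^2 = \lambda(z) \sum_{i=0}^7 v_i^2$ for all $z \in D$ and all $(v_0,\ldots,v_7) \in \mathbb{R}^8$. *)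

theory Defs
  imports "HOL-Analysis.Analysis"
begin

text \<open>
  The octonions are identified with \<open>real ^ 8\<close>, so topology, inner product and norm are the
  Euclidean ones. The index type \<open>8\<close> has exactly the elements \<open>0, 1, \<dots>, 7\<close> (with \<open>8 = 0\<close>), and
  \<open>a $ 0\<close> is the real part; indices \<open>1, \<dots>, 7\<close> are expressed by \<open>i \<noteq> 0\<close>.
  The operation \<open>*\<close> on \<open>real ^ 8\<close> is componentwise and is \<^emph>\<open>not\<close> the octonion product, which is
  written \<open>\<odot>\<close> below.
\<close>

type_synonym octonion = "real ^ 8"

definition oct_Re :: "octonion \<Rightarrow> real" where
  "oct_Re a = a $ 0"

definition oct_e :: "8 \<Rightarrow> octonion" where
  "oct_e i = axis i 1"

definition oct_triples :: "(8 \<times> 8 \<times> 8) set" where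
  "oct_triples = {(1,2,4), (1,3,5), (2,3,6), (4,3,7), (6,1,7), (2,5,7), (4,6,5)}"

definition oct_cyclic :: "8 \<Rightarrow> 8 \<Rightarrow> 8 \<Rightarrow> bool" where
  "oct_cyclic i j k \<longleftrightarrow>
     (i,j,k) \<in> oct_triples \<or> (j,k,i) \<in> oct_triples \<or> (k,i,j) \<in> oct_triples"

text \<open>The structure constant \<open>oct_coeff i j k\<close> is the \<open>e\<^sub>k\<close>-coordinate of \<open>e\<^sub>i e\<^sub>j\<close>, where \<open>e\<^sub>0 = 1\<close>.\<close>

definition oct_coeff :: "8 \<Rightarrow> 8 \<Rightarrow> 8 \<Rightarrow> real" where
  "oct_coeff i j k =
     (if i = 0 then (if k = j then 1 else 0)
      else if j = 0 then (if k = i then 1 else 0)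
      else if i = j then (if k = 0 then -1 else 0)
      else if oct_cyclic i j k then 1
      else if oct_cyclic j i k then -1
      else 0)"

definition oct_mult :: "octonion \<Rightarrow> octonion \<Rightarrow> octonion"  (infixl "\<odot>" 70) where
  "a \<odot> b = (\<chi> k. \<Sum>i\<in>UNIV. \<Sum>j\<in>UNIV. oct_coeff i j k * (a $ i) * (b $ j))"

lemma bilinear_oct_mult: "bilinear (\<odot>)"
  unfolding bilinear_def
  by (auto intro!: linearI simp: oct_mult_def vec_eq_iff algebra_simps
        sum.distrib sum_distrib_left)

lemma oct_e_mult_nth: "(oct_e i \<odot> oct_e j) $ k = oct_coeff i j k"
proof -
  have "(oct_e i \<odot> oct_e j) $ k =
      (\<Sum>i'\<in>UNIV. \<Sum>j'\<in>UNIV. if i' = i then (if j' = j then oct_coeff i j k else 0) else 0)"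
    unfolding oct_mult_def oct_e_def axis_def by (auto intro!: sum.cong)
  also have "\<dots> = (\<Sum>i'\<in>UNIV. if i' = i then oct_coeff i j k else 0)"
    by (intro sum.cong) auto
  finally show ?thesis by simp
qed

lemma oct_e_0_mult: "oct_e 0 \<odot> oct_e j = oct_e j"
  by (simp add: vec_eq_iff oct_e_mult_nth oct_coeff_def) (simp add: oct_e_def axis_def)

lemma oct_mult_e_0: "oct_e i \<odot> oct_e 0 = oct_e i"
  by (simp add: vec_eq_iff oct_e_mult_nth oct_coeff_def) (simp add: oct_e_def axis_def)

lemma oct_e_square: "i \<noteq> 0 \<Longrightarrow> oct_e i \<odot> oct_e i = - oct_e 0"
  by (simp add: vec_eq_iff oct_e_mult_nth oct_coeff_def) (simp add: oct_e_def axis_def)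

lemma oct_cyclic_rule:
  assumes "oct_cyclic i j k"
    and "\<And>i j k. (i,j,k) \<in> oct_triples \<Longrightarrow> P i j k \<and> P j k i \<and> P k i j"
  shows "P i j k"
  using assms(1) assms(2)[of i j k] assms(2)[of j k i] assms(2)[of k i j]
  unfolding oct_cyclic_def by argo

lemma oct_cyclic_distinct: "oct_cyclic i j k \<Longrightarrow> i \<noteq> 0 \<and> j \<noteq> 0 \<and> i \<noteq> j"
  by (erule oct_cyclic_rule) (auto simp: oct_triples_def)

lemma oct_cyclic_unique: "oct_cyclic i j k \<Longrightarrow> oct_cyclic i j l \<longleftrightarrow> l = k"
  by (erule oct_cyclic_rule)
    (unfold oct_triples_def oct_cyclic_def insert_iff empty_iff prod.inject,
     elim disjE conjE FalseE; simp)

lemma oct_cyclic_asym: "oct_cyclic i j k \<Longrightarrow> \<not> oct_cyclic j i l"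
  by (erule oct_cyclic_rule)
    (unfold oct_triples_def oct_cyclic_def insert_iff empty_iff prod.inject,
     elim disjE conjE FalseE; simp)

lemma oct_e_mult_cyclic:
  assumes "oct_cyclic i j k" shows "oct_e i \<odot> oct_e j = oct_e k"
  using oct_cyclic_distinct[OF assms] oct_cyclic_unique[OF assms] oct_cyclic_asym[OF assms]
  by (simp add: vec_eq_iff oct_e_mult_nth oct_coeff_def) (simp add: oct_e_def axis_def)

lemma oct_e_anticommute:
  assumes "i \<noteq> 0" "j \<noteq> 0" "i \<noteq> j"
  shows "oct_e i \<odot> oct_e j = - (oct_e j \<odot> oct_e i)"
  using assms oct_cyclic_asym[of i j] oct_cyclic_asym[of j i]
  by (auto simp add: vec_eq_iff oct_e_mult_nth oct_coeff_def)

text \<open>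
  Functions on \<open>D\<close> are modelled by total functions. The notions below are used for open \<open>D\<close>,
  where they depend only on the values of \<open>f\<close> on \<open>D\<close>.
\<close>

definition partial_deriv :: "8 \<Rightarrow> (octonion \<Rightarrow> octonion) \<Rightarrow> octonion \<Rightarrow> octonion" where
  "partial_deriv i f z = vector_derivative (\<lambda>t::real. f (z + t *\<^sub>R oct_e i)) (at 0)"

definition C1_real_on :: "octonion set \<Rightarrow> (octonion \<Rightarrow> real) \<Rightarrow> bool" where
  "C1_real_on D g \<longleftrightarrow>
     (\<exists>g' :: octonion \<Rightarrow> octonion \<Rightarrow>\<^sub>L real.
        (\<forall>z\<in>D. (g has_derivative blinfun_apply (g' z)) (at z)) \<and> continuous_on D g')"

definition C1_on :: "octonion set \<Rightarrow> (octonion \<Rightarrow> octonion) \<Rightarrow> bool" where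
  "C1_on D f \<longleftrightarrow> (\<forall>j. C1_real_on D (\<lambda>z. f z $ j))"

definition gauss_conformal_on :: "octonion set \<Rightarrow> (octonion \<Rightarrow> octonion) \<Rightarrow> bool" where
  "gauss_conformal_on D f \<longleftrightarrow>
     (\<exists>l :: octonion \<Rightarrow> real. \<forall>z\<in>D. l z > 0 \<and>
        (\<forall>v :: real ^ 8.
           (norm (\<Sum>i\<in>UNIV. v $ i *\<^sub>R partial_deriv i f z))\<^sup>2 = l z * (\<Sum>i\<in>UNIV. (v $ i)\<^sup>2)))"

end

theory Submission
  imports Defs
begin

text \<open>
  Conformality at a point says that the eight partial derivatives \<open>p\<^sub>0, \<dots>, p\<^sub>7\<close> are pairwise
  orthogonal of equal positive length; this is polarization (\<open>norm_square_iff_gram\<close>). So the theorem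
  compares orthogonality of the \<open>p\<^sub>k\<close> with orthonormality of \<open>1, \<Psi>\<^sub>1, \<dots>, \<Psi>\<^sub>7\<close>, where
  \<open>p\<^sub>k = \<Psi>\<^sub>k \<odot> p\<^sub>0\<close>. The bridge is that right multiplication by \<open>b = p\<^sub>0\<close> is \<open>\<bar>b\<bar>\<close> times a
  linear isometry, \<open>\<langle>a \<odot> b, c \<odot> b\<rangle> = \<langle>a, c\<rangle> \<bar>b\<bar>\<^sup>2\<close> (\<open>inner_oct_mult_right\<close>), and is therefore
  invertible when \<open>b \<noteq> 0\<close>.

  Octonion multiplication is not associative, so division by \<open>p\<^sub>0\<close> needs care: it works because
  \<open>(a \<odot> b) \<odot> b\<^sup>* = \<bar>b\<bar>\<^sup>2 a\<close> (\<open>oct_mult_conj_cancel\<close>), with \<open>b\<^sup>*\<close> the conjugate of \<open>b\<close>. This forces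
  \<open>\<Psi>\<^sub>k = p\<^sub>k \<odot> p\<^sub>0\<^sup>* / \<bar>p\<^sub>0\<bar>\<^sup>2\<close>, an explicit formula from which continuity of \<open>\<Psi>\<^sub>k\<close> follows from that of
  the partial derivatives. The real part of \<open>p\<^sub>k \<odot> p\<^sub>0\<^sup>*\<close> is \<open>\<langle>p\<^sub>k, p\<^sub>0\<rangle>\<close>, so \<open>\<Psi>\<^sub>k\<close> is purely imaginary
  exactly when \<open>p\<^sub>k\<close> is orthogonal to \<open>p\<^sub>0\<close>.
\<close>

lemma UNIV_8: "(UNIV :: 8 set) = {0,1,2,3,4,5,6,7}"
  by (rule sym, rule card_subset_eq) simp_all
lemma sum_8: "(\<Sum>i\<in>UNIV. f (i::8)) = f 0 + f 1 + f 2 + f 3 + f 4 + f 5 + f 6 + f 7"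
  for f :: "8 \<Rightarrow> 'a::comm_monoid_add"
  unfolding UNIV_8 by (simp add: add.assoc)
lemma forall_8: "(\<forall>i::8. P i) \<longleftrightarrow> P 0 \<and> P 1 \<and> P 2 \<and> P 3 \<and> P 4 \<and> P 5 \<and> P 6 \<and> P 7"
  using UNIV_8 by (metis (no_types) UNIV_I empty_iff insert_iff)

definition oct_conj :: "octonion \<Rightarrow> octonion" where
  "oct_conj a = (\<chi> i. if i = 0 then a $ 0 else - (a $ i))"

lemma oct_coeff_cyclic:
  assumes "oct_cyclic i j k"
  shows "oct_coeff i j l = (if l = k then 1 else 0)"
    and "oct_coeff j i l = (if l = k then -1 else 0)"
  using oct_cyclic_distinct[OF assms] oct_cyclic_unique[OF assms] oct_cyclic_asym[OF assms]
  by (auto simp: oct_coeff_def)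

text \<open>
  Each line of the Fano plane determines six products of imaginary units. Reading off the
  multiplication table line by line keeps the evaluation of products to plain rewriting.
\<close>

lemma oct_coeff_triple:
  assumes "(i, j, k) \<in> oct_triples"
  shows "oct_coeff i j l = (if l = k then 1 else 0)" "oct_coeff j i l = (if l = k then -1 else 0)"
    "oct_coeff j k l = (if l = i then 1 else 0)" "oct_coeff k j l = (if l = i then -1 else 0)"
    "oct_coeff k i l = (if l = j then 1 else 0)" "oct_coeff i k l = (if l = j then -1 else 0)"
  by (rule oct_coeff_cyclic, use assms in \<open>simp add: oct_cyclic_def\<close>)+

lemma oct_triples_members:
  "(1,2,4) \<in> oct_triples" "(1,3,5) \<in> oct_triples" "(2,3,6) \<in> oct_triples"
  "(4,3,7) \<in> oct_triples" "(6,1,7) \<in> oct_triples" "(2,5,7) \<in> oct_triples"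
  "(4,6,5) \<in> oct_triples"
  by (simp_all add: oct_triples_def)

lemma oct_coeff_unit:
  "oct_coeff 0 j l = (if l = j then 1 else 0)"
  "oct_coeff i 0 l = (if l = i then 1 else 0)"
  "i \<noteq> 0 \<Longrightarrow> oct_coeff i i l = (if l = 0 then -1 else 0)"
  by (simp_all add: oct_coeff_def)

lemmas oct_coeff_table = oct_coeff_unit oct_triples_members[THEN oct_coeff_triple(1)]
  oct_triples_members[THEN oct_coeff_triple(2)] oct_triples_members[THEN oct_coeff_triple(3)]
  oct_triples_members[THEN oct_coeff_triple(4)] oct_triples_members[THEN oct_coeff_triple(5)]
  oct_triples_members[THEN oct_coeff_triple(6)]

lemma oct_mult_nth:
  shows
    "(a \<odot> b) $ 0 = a$0*b$0 - a$1*b$1 - a$2*b$2 - a$3*b$3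
       - a$4*b$4 - a$5*b$5 - a$6*b$6 - a$7*b$7"
    "(a \<odot> b) $ 1 = a$0*b$1 + a$1*b$0 + a$2*b$4 + a$3*b$5
       - a$4*b$2 - a$5*b$3 - a$6*b$7 + a$7*b$6"
    "(a \<odot> b) $ 2 = a$0*b$2 - a$1*b$4 + a$2*b$0 + a$3*b$6
       + a$4*b$1 + a$5*b$7 - a$6*b$3 - a$7*b$5"
    "(a \<odot> b) $ 3 = a$0*b$3 - a$1*b$5 - a$2*b$6 + a$3*b$0
       - a$4*b$7 + a$5*b$1 + a$6*b$2 + a$7*b$4"
    "(a \<odot> b) $ 4 = a$0*b$4 + a$1*b$2 - a$2*b$1 + a$3*b$7
       + a$4*b$0 - a$5*b$6 + a$6*b$5 - a$7*b$3"
    "(a \<odot> b) $ 5 = a$0*b$5 + a$1*b$3 - a$2*b$7 - a$3*b$1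
       + a$4*b$6 + a$5*b$0 - a$6*b$4 + a$7*b$2"
    "(a \<odot> b) $ 6 = a$0*b$6 + a$1*b$7 + a$2*b$3 - a$3*b$2
       - a$4*b$5 + a$5*b$4 + a$6*b$0 - a$7*b$1"
    "(a \<odot> b) $ 7 = a$0*b$7 - a$1*b$6 + a$2*b$5 - a$3*b$4
       + a$4*b$3 - a$5*b$2 + a$6*b$1 + a$7*b$0"
  by (simp_all add: oct_mult_def sum_8 oct_coeff_table)

lemma oct_conj_nth: "oct_conj b $ 0 = b $ 0" "i \<noteq> 0 \<Longrightarrow> oct_conj b $ i = - (b $ i)"
  by (simp_all add: oct_conj_def)

lemma oct_inner: "a \<bullet> b = a$0*b$0 + a$1*b$1 + a$2*b$2 + a$3*b$3 + a$4*b$4 + a$5*b$5 + a$6*b$6 + a$7*b$7"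
  for a b :: octonion
  by (simp add: inner_vec_def sum_8)

text \<open>
  The next two identities stand in for associativity: the first makes multiplication by the conjugate
  the adjoint of right multiplication, the second makes it the inverse up to \<open>\<bar>b\<bar>\<^sup>2\<close>. Both are
  polynomial identities in the coordinates, true by expansion.
\<close>

lemma oct_mult_adjoint: "(a \<odot> b) \<bullet> c = a \<bullet> (c \<odot> oct_conj b)"
  by (simp add: oct_inner oct_mult_nth oct_conj_nth algebra_simps)

lemma oct_mult_conj_cancel: "(a \<odot> b) \<odot> oct_conj b = (b \<bullet> b) *\<^sub>R a"
  unfolding vec_eq_iff forall_8
  by (simp add: oct_inner oct_mult_nth oct_conj_nth algebra_simps)

lemma oct_conj_conj: "oct_conj (oct_conj b) = b"
  by (simp add: oct_conj_def vec_eq_iff)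

lemma oct_conj_inner_self: "oct_conj b \<bullet> oct_conj b = b \<bullet> b"
  by (simp add: oct_inner oct_conj_nth)

lemma oct_mult_conj_cancel': "(a \<odot> oct_conj b) \<odot> b = (b \<bullet> b) *\<^sub>R a"
  using oct_mult_conj_cancel[of a "oct_conj b"] by (simp add: oct_conj_conj oct_conj_inner_self)

text \<open>
  Multiplicativity of the norm, polarized: moving the \<open>b\<close> of \<open>a \<odot> b\<close> across the inner product turns
  it into \<open>oct_conj b\<close>, which cancels the \<open>b\<close> of \<open>c \<odot> b\<close>.
\<close>

lemma inner_oct_mult_right: "(a \<odot> b) \<bullet> (c \<odot> b) = (a \<bullet> c) * (b \<bullet> b)"
  by (simp add: oct_mult_adjoint oct_mult_conj_cancel)

lemma oct_one_mult: "oct_e 0 \<odot> b = b"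
  unfolding vec_eq_iff forall_8 by (simp add: oct_mult_nth oct_e_def axis_def)

lemma oct_Re_mult_conj: "oct_Re (a \<odot> oct_conj b) = a \<bullet> b"
  by (simp add: oct_Re_def oct_mult_nth oct_conj_nth oct_inner)

lemma oct_Re_scaleR: "oct_Re (r *\<^sub>R a) = r * oct_Re a"
  by (simp add: oct_Re_def)

lemma oct_mult_scaleR_left: "(r *\<^sub>R a) \<odot> b = r *\<^sub>R (a \<odot> b)"
  by (rule bilinear_lmul[OF bilinear_oct_mult])

lemma continuous_on_oct_mult:
  "continuous_on D f \<Longrightarrow> continuous_on D g \<Longrightarrow> continuous_on D (\<lambda>z. f z \<odot> g z)"
  for f g :: "'a::t2_space \<Rightarrow> octonion"
  by (rule bilinear_continuous_on_compose[OF _ _ bilinear_oct_mult])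

lemma continuous_on_oct_conj: "continuous_on D f \<Longrightarrow> continuous_on D (\<lambda>z. oct_conj (f z))"
  unfolding oct_conj_def
proof (intro continuous_on_vec_lambda)
  fix i
  assume "continuous_on D f"
  then show "continuous_on D (\<lambda>z. if i = 0 then f z $ 0 else - (f z $ i))"
    by (cases "i = 0") (auto intro!: continuous_intros)
qed

text \<open>
  A linear map scales all squared norms by \<open>l\<close> iff it scales all inner products by \<open>l\<close>
  (polarization), and the latter need only be tested on the standard basis, whose images are the
  \<open>p i\<close>. For the partial derivatives of \<open>f\<close> at a point, the left side is the Gauss condition.
\<close>

lemma norm_square_iff_gram:
  fixes p :: "'n::finite \<Rightarrow> 'a::real_inner"
  shows "(\<forall>v :: real ^ 'n. (norm (\<Sum>i\<in>UNIV. v $ i *\<^sub>R p i))\<^sup>2 = l * (\<Sum>i\<in>UNIV. (v $ i)\<^sup>2)) \<longleftrightarrow>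
    (\<forall>i j. p i \<bullet> p j = (if i = j then l else 0))"
    (is "?L \<longleftrightarrow> ?R")
proof
  assume L: ?L
  define B where "B v = (\<Sum>i\<in>UNIV. v $ i *\<^sub>R p i)" for v :: "real ^ 'n"
  have norm_B: "B v \<bullet> B v = l * (v \<bullet> v)" for v
    using L by (simp add: B_def inner_vec_def power2_norm_eq_inner[symmetric] power2_eq_square[symmetric])
  have add_B: "B (u + v) = B u + B v" for u v
    by (simp add: B_def scaleR_add_left sum.distrib)
  have polarized: "B u \<bullet> B v = l * (u \<bullet> v)" for u v
  proof -
    have "B (u + v) \<bullet> B (u + v) = B u \<bullet> B u + 2 * (B u \<bullet> B v) + B v \<bullet> B v"
      by (simp add: add_B inner_add inner_commute)
    moreover have "l * ((u + v) \<bullet> (u + v)) = l * (u \<bullet> u) + 2 * (l * (u \<bullet> v)) + l * (v \<bullet> v)"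
      by (simp add: inner_add inner_commute algebra_simps)
    ultimately show ?thesis
      by (simp add: norm_B)
  qed
  have B_axis: "B (axis i 1) = p i" for i
  proof -
    have "B (axis i 1) = (\<Sum>k\<in>UNIV. if k = i then p i else 0)"
      unfolding B_def by (intro sum.cong) (auto simp: axis_def)
    then show ?thesis by simp
  qed
  show ?R
    using polarized[of "axis _ 1" "axis _ 1"] by (simp add: B_axis inner_axis_axis)
next
  assume R: ?R
  show ?L
  proof
    fix v :: "real ^ 'n"
    have "(norm (\<Sum>i\<in>UNIV. v $ i *\<^sub>R p i))\<^sup>2 = (\<Sum>i\<in>UNIV. \<Sum>j\<in>UNIV. v $ i * (v $ j * (p j \<bullet> p i)))"
      by (simp add: power2_norm_eq_inner inner_sum_left inner_sum_right sum_distrib_left)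
    also have "\<dots> = (\<Sum>i\<in>UNIV. \<Sum>j\<in>UNIV. if j = i then l * (v $ i)\<^sup>2 else 0)"
      using R by (intro sum.cong) (auto simp: power2_eq_square)
    finally show "(norm (\<Sum>i\<in>UNIV. v $ i *\<^sub>R p i))\<^sup>2 = l * (\<Sum>i\<in>UNIV. (v $ i)\<^sup>2)"
      by (simp add: sum_distrib_left)
  qed
qed

text \<open>
  On \<open>D\<close> the partial derivative, defined through a vector derivative along a line, is the total
  derivative applied to a basis vector; the continuity of the latter in the operator norm is what the
  \<open>C\<^sup>1\<close> hypothesis provides.
\<close>

lemma continuous_on_partial_deriv:
  assumes "C1_on D f"
  shows "continuous_on D (partial_deriv i f)"
proof -
  obtain g where deriv_g: "\<And>j z. z \<in> D \<Longrightarrow> ((\<lambda>z. f z $ j) has_derivative blinfun_apply (g j z)) (at z)"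
    and cont_g: "\<And>j. continuous_on D (g j)"
    using assms unfolding C1_on_def C1_real_on_def by metis
  have partial: "partial_deriv i f z = (\<chi> j. g j z (oct_e i))" if "z \<in> D" for z
  proof -
    have "(f has_derivative (\<lambda>h. \<chi> j. g j z h)) (at z)"
      using deriv_g[OF that]
      by (subst has_derivative_componentwise_within) (auto simp: Basis_vec_def inner_axis)
    moreover have "((\<lambda>t. z + t *\<^sub>R oct_e i) has_vector_derivative oct_e i) (at (0::real))"
      by (auto intro!: derivative_eq_intros)
    ultimately have "((\<lambda>t. f (z + t *\<^sub>R oct_e i)) has_vector_derivative (\<chi> j. g j z (oct_e i)))
        (at (0::real))"
      using vector_derivative_diff_chain_within
        [of "\<lambda>t. z + t *\<^sub>R oct_e i" "oct_e i" 0 UNIV f "\<lambda>h. \<chi> j. g j z h"]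
      by (simp add: o_def has_derivative_at_withinI)
    then show ?thesis
      unfolding partial_deriv_def by (rule vector_derivative_at)
  qed
  have "continuous_on D (\<lambda>z. \<chi> j. g j z (oct_e i))"
    by (intro continuous_on_vec_lambda blinfun.continuous_on cont_g continuous_on_const)
  then show ?thesis
    using partial by (simp cong: continuous_on_cong)
qed

theorem theorem3p5:
  fixes D :: "octonion set" and f :: "octonion \<Rightarrow> octonion"
  assumes "open D" and "connected D" and "D \<noteq> {}"
    and "C1_on D f"
    and "\<And>z. z \<in> D \<Longrightarrow> partial_deriv 0 f z \<noteq> 0"
  shows "gauss_conformal_on D f \<longleftrightarrow>
    (\<exists>\<Psi> :: 8 \<Rightarrow> octonion \<Rightarrow> octonion.
       (\<forall>i. i \<noteq> 0 \<longrightarrow> continuous_on D (\<Psi> i)) \<and>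
       (\<forall>z\<in>D.
          (\<forall>i. i \<noteq> 0 \<longrightarrow> oct_Re (\<Psi> i z) = 0) \<and>
          (\<forall>i j. i \<noteq> 0 \<longrightarrow> j \<noteq> 0 \<longrightarrow> \<Psi> i z \<bullet> \<Psi> j z = (if i = j then 1 else 0)) \<and>
          (\<forall>k. k \<noteq> 0 \<longrightarrow> partial_deriv k f z = \<Psi> k z \<odot> partial_deriv 0 f z)))"
proof -
  let ?p = "\<lambda>k z. partial_deriv k f z"
  have gram: "gauss_conformal_on D f \<longleftrightarrow>
      (\<exists>l. \<forall>z\<in>D. l z > 0 \<and> (\<forall>i j. ?p i z \<bullet> ?p j z = (if i = j then l z else 0)))"
    unfolding gauss_conformal_on_def norm_square_iff_gram ..
  show ?thesis
  proof
    assume "gauss_conformal_on D f"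
    then obtain l where l: "\<And>z i j. z \<in> D \<Longrightarrow> ?p i z \<bullet> ?p j z = (if i = j then l z else 0)"
      unfolding gram by blast
    define \<Psi> where
      "\<Psi> k z = (1 / (?p 0 z \<bullet> ?p 0 z)) *\<^sub>R (?p k z \<odot> oct_conj (?p 0 z))" for k z
    have "continuous_on D (\<Psi> k)" for k
      unfolding \<Psi>_def using assms(4,5)
      by (intro continuous_intros continuous_on_partial_deriv continuous_on_oct_mult
          continuous_on_oct_conj) auto
    moreover have "oct_Re (\<Psi> k z) = 0" if "z \<in> D" "k \<noteq> 0" for k z
      using l[OF that(1), of k 0] that(2) by (simp add: \<Psi>_def oct_Re_scaleR oct_Re_mult_conj)
    moreover have "\<Psi> i z \<bullet> \<Psi> j z = (if i = j then 1 else 0)" if "z \<in> D" for i j z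
      using l[OF that, of i j] l[OF that, of 0 0] assms(5)[OF that]
      by (auto simp: \<Psi>_def inner_oct_mult_right oct_conj_inner_self)
    moreover have "?p k z = \<Psi> k z \<odot> ?p 0 z" if "z \<in> D" for k z
      using assms(5)[OF that] by (simp add: \<Psi>_def oct_mult_scaleR_left oct_mult_conj_cancel')
    ultimately show "\<exists>\<Psi>. (\<forall>i. i \<noteq> 0 \<longrightarrow> continuous_on D (\<Psi> i)) \<and>
       (\<forall>z\<in>D.
          (\<forall>i. i \<noteq> 0 \<longrightarrow> oct_Re (\<Psi> i z) = 0) \<and>
          (\<forall>i j. i \<noteq> 0 \<longrightarrow> j \<noteq> 0 \<longrightarrow> \<Psi> i z \<bullet> \<Psi> j z = (if i = j then 1 else 0)) \<and>
          (\<forall>k. k \<noteq> 0 \<longrightarrow> ?p k z = \<Psi> k z \<odot> ?p 0 z))"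
      by blast
  next
    assume "\<exists>\<Psi>. (\<forall>i. i \<noteq> 0 \<longrightarrow> continuous_on D (\<Psi> i)) \<and>
       (\<forall>z\<in>D.
          (\<forall>i. i \<noteq> 0 \<longrightarrow> oct_Re (\<Psi> i z) = 0) \<and>
          (\<forall>i j. i \<noteq> 0 \<longrightarrow> j \<noteq> 0 \<longrightarrow> \<Psi> i z \<bullet> \<Psi> j z = (if i = j then 1 else 0)) \<and>
          (\<forall>k. k \<noteq> 0 \<longrightarrow> ?p k z = \<Psi> k z \<odot> ?p 0 z))"
    then obtain \<Psi> where \<Psi>: "\<forall>z\<in>D.
          (\<forall>i. i \<noteq> 0 \<longrightarrow> oct_Re (\<Psi> i z) = 0) \<and>
          (\<forall>i j. i \<noteq> 0 \<longrightarrow> j \<noteq> 0 \<longrightarrow> \<Psi> i z \<bullet> \<Psi> j z = (if i = j then 1 else 0)) \<and>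
          (\<forall>k. k \<noteq> 0 \<longrightarrow> ?p k z = \<Psi> k z \<odot> ?p 0 z)"
      by (elim exE conjE)
    \<comment> \<open>Adjoining \<open>e\<^sub>0 = 1\<close> treats all eight partial derivatives alike: the purely imaginary
      \<open>\<Psi>\<^sub>1, \<dots>, \<Psi>\<^sub>7\<close> are orthogonal to it.\<close>
    define \<Phi> where "\<Phi> k z = (if k = 0 then oct_e 0 else \<Psi> k z)" for k z
    have "?p k z = \<Phi> k z \<odot> ?p 0 z" if "z \<in> D" for k z
      using \<Psi> that by (simp add: \<Phi>_def oct_one_mult)
    moreover have "\<Phi> i z \<bullet> \<Phi> j z = (if i = j then 1 else 0)" if "z \<in> D" for i j z
      using bspec[OF \<Psi> that] by (auto simp: \<Phi>_def oct_Re_def oct_e_def inner_axis inner_axis')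
    ultimately have "?p i z \<bullet> ?p j z = (if i = j then ?p 0 z \<bullet> ?p 0 z else 0)" if "z \<in> D" for i j z
      using that by (metis inner_oct_mult_right mult_1 mult_zero_left)
    moreover have "?p 0 z \<bullet> ?p 0 z > 0" if "z \<in> D" for z
      using assms(5)[OF that] by simp
    ultimately show "gauss_conformal_on D f"
      unfolding gram by (intro exI[of _ "\<lambda>z. ?p 0 z \<bullet> ?p 0 z"]) blast
  qed
qed

end
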